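(* Let $m>0$, $g\in\mathbb{R}\setminus\{0\}$, let $\Lambda$ be a finite set of unit cells with $|\Lambda|\ge2$, and consider the nonlinear breathing kagome lattice with vanishing inter-cell hopping, with stability matrix $J\mathcal{L}$ of a breather as defined in the context. Let $\phi$ be a breather supported in a single unit cell $R_0\in\Lambda$, i.e. $\phi_{(R,\alpha)}=\delta_{R,R_0}\phi_\alpha$. (1) (Type III) If $(\phi_A,\phi_B,\phi_C)=\frac{1}{\sqrt2}(1,-1,0)$ and $\omega=m+\frac g2$, then the non-zero stability spectrum (the set of non-zero eigenvalues of $J\mathcal{L}$) consists of the non-zero numbers among $$\pm i\sqrt{\tfrac12\left(\gamma\pm\sqrt{\gamma^2+2mg^3}\right)},\qquad \pm i\,\frac g2,\qquad \pm i\left(3m+\frac g2\right),\qquad\text{where }\gamma=9m^2-mg+\frac{g^2}{4},$$ with all choices of signs (inner and outer signs being independent). The region of linear stability of the Type III breather is $$-9.07\,m\lesssim g\le 0,$$ where the left boundary is a point at which $\gamma^2+2mg^3=0$, found numerically to be at $g\approx-9.07\,m$, and the right boundary is $g=0$. (2) (Type IV) If $(\phi_A,\phi_B,\phi_C)=\frac{1}{\sqrt3}(1,1,1)$ and $\omega=-2m+\frac g3$, then the non-zero stability spectrum consists of the non-zero numbers among $$\pm i\sqrt{m(9m+2g)},\qquad \pm i\,\frac g3,\qquad \pm i\left(3m-\frac g3\right).$$ Consequently the Type IV breather is linearly stable for $g\ge-\frac{9m}{2}$. Here square roots of negative or complex numbers denote either complex square root.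
   Context: Sites are labelled $a=(R,\alpha)$ with $R\in\Lambda$ and $\alpha\in\{A,B,C\}$. The hopping matrix (inter-cell hopping zero) is $h_{(R,\alpha),(R',\beta)}=\delta_{R,R'}h_{\alpha\beta}$ with $h_{\alpha\alpha}=0$ and $h_{\alpha\beta}=-m$ for $\alpha\neq\beta$. A (real) breather with frequency $\omega\in\mathbb{R}$ is a real vector $\phi=(\phi_a)$ with $\sum_a\phi_a^2=1$ and $\sum_bh_{ab}\phi_b+g\phi_a^3=\omega\phi_a$ for all $a$. Its stability matrix is the real $6|\Lambda|\times6|\Lambda|$ matrix $$J\mathcal{L}=\begin{pmatrix}0&-\mathcal{L}_+\\ \mathcal{L}_-&0\end{pmatrix},\qquad (\mathcal{L}_\pm)_{ab}=h_{ab}-\omega\delta_{ab}+(2\pm1)g\phi_a^2\delta_{ab}.$$ The breather is called linearly stable if all eigenvalues of $J\mathcal{L}$ lie on the imaginary axis. The symbol $\lesssim$ indicates that the endpoint is a numerically determined approximate value.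
   Formalization: The Type III breather is also linearly stable for g ≤ -18m (e.g. m=1, g=-20), so the stated interval is proved to be the connected component of g=0 in the stable set, the full set being g ≤ -18m or g_l ≤ g ≤ 0, with g_l within 0.01m of -9.07m. *)

theory Defs
  imports "HOL-Analysis.Analysis"
begin

text \<open>The three sites of a unit cell.  A finite type \<open>'c\<close> plays the role of the set of unit
  cells, so sites are pairs in \<open>'c \<times> sublattice\<close>.\<close>

datatype sublattice = SubA | SubB | SubC

instance sublattice :: finite
proof
  have "(UNIV :: sublattice set) = {SubA, SubB, SubC}"
    using sublattice.exhaust by blast
  then show "finite (UNIV :: sublattice set)"
    by (metis finite.emptyI finite_insert)
qed

definition hopping ::
  "real \<Rightarrow> real ^ ('c::finite \<times> sublattice) ^ ('c \<times> sublattice)" where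
  "hopping m = (\<chi> a b. if fst a = fst b \<and> snd a \<noteq> snd b then - m else 0)"

definition is_breather ::
  "real ^ ('a::finite) ^ 'a \<Rightarrow> real \<Rightarrow> real \<Rightarrow> real ^ 'a \<Rightarrow> bool" where
  "is_breather h g \<omega> \<phi> \<longleftrightarrow>
     (\<Sum>a\<in>UNIV. (\<phi> $ a)\<^sup>2) = 1 \<and>
     (\<forall>a. (\<Sum>b\<in>UNIV. h $ a $ b * \<phi> $ b) + g * (\<phi> $ a) ^ 3 = \<omega> * \<phi> $ a)"

text \<open>The sign \<open>s\<close> is \<open>1\<close> for \<open>\<L>\<^sub>+\<close> and \<open>-1\<close> for \<open>\<L>\<^sub>-\<close>.\<close>

definition linearization ::
  "real \<Rightarrow> real ^ ('a::finite) ^ 'a \<Rightarrow> real \<Rightarrow> real \<Rightarrow> real ^ 'a \<Rightarrow> real ^ 'a ^ 'a" where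
  "linearization s h g \<omega> \<phi> =
     (\<chi> a b. h $ a $ b - \<omega> * of_bool (a = b) + (2 + s) * g * (\<phi> $ a)\<^sup>2 * of_bool (a = b))"

text \<open>Rows and columns of the block matrix are indexed by the disjoint sum of two copies of the
  set of sites.\<close>

definition stability_matrix ::
  "real ^ ('a::finite) ^ 'a \<Rightarrow> real \<Rightarrow> real \<Rightarrow> real ^ 'a \<Rightarrow> real ^ ('a + 'a) ^ ('a + 'a)" where
  "stability_matrix h g \<omega> \<phi> = (\<chi> i j.
     case i of
       Inl a \<Rightarrow> (case j of Inl b \<Rightarrow> 0
                         | Inr b \<Rightarrow> - (linearization 1 h g \<omega> \<phi> $ a $ b))
     | Inr a \<Rightarrow> (case j of Inl b \<Rightarrow> linearization (- 1) h g \<omega> \<phi> $ a $ b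
                         | Inr b \<Rightarrow> 0))"

text \<open>Complex eigenvalues of a real square matrix.\<close>

definition eigenvalues :: "real ^ ('n::finite) ^ 'n \<Rightarrow> complex set" where
  "eigenvalues M = {z. \<exists>v. v \<noteq> 0 \<and> map_matrix complex_of_real M *v v = z *s v}"

definition nonzero_stability_spectrum ::
  "real ^ ('a::finite) ^ 'a \<Rightarrow> real \<Rightarrow> real \<Rightarrow> real ^ 'a \<Rightarrow> complex set" where
  "nonzero_stability_spectrum h g \<omega> \<phi> = eigenvalues (stability_matrix h g \<omega> \<phi>) - {0}"

definition linearly_stable ::
  "real ^ ('a::finite) ^ 'a \<Rightarrow> real \<Rightarrow> real \<Rightarrow> real ^ 'a \<Rightarrow> bool" where
  "linearly_stable h g \<omega> \<phi> \<longleftrightarrow> (\<forall>z\<in>eigenvalues (stability_matrix h g \<omega> \<phi>). Re z = 0)"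

definition single_cell ::
  "'c \<Rightarrow> real ^ sublattice \<Rightarrow> real ^ ('c::finite \<times> sublattice)" where
  "single_cell R\<^sub>0 v = (\<chi> a. if fst a = R\<^sub>0 then v $ snd a else 0)"

definition type_III :: "real ^ sublattice" where
  "type_III = (\<chi> \<alpha>. case \<alpha> of SubA \<Rightarrow> 1 / sqrt 2 | SubB \<Rightarrow> - 1 / sqrt 2 | SubC \<Rightarrow> 0)"

definition type_IV :: "real ^ sublattice" where
  "type_IV = (\<chi> \<alpha>. 1 / sqrt 3)"

definition type_III_gamma :: "real \<Rightarrow> real \<Rightarrow> real" where
  "type_III_gamma m g = 9 * m\<^sup>2 - m * g + g\<^sup>2 / 4"

text \<open>Here \<open>g\<close> ranges over all reals, including the linear case \<open>g = 0\<close>, which is the right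
  endpoint of the region.\<close>

definition type_III_stability_region :: "real \<Rightarrow> 'c::finite \<Rightarrow> real set" where
  "type_III_stability_region m R\<^sub>0 = {g.
     is_breather (hopping m) g (m + g / 2) (single_cell R\<^sub>0 type_III) \<and>
     linearly_stable (hopping m) g (m + g / 2) (single_cell R\<^sub>0 type_III)}"

text \<open>Since \<open>\<gamma>\<^sup>2 + 2 m g\<^sup>3 = (g + 18 m) (g\<^sup>3 + 6 m g\<^sup>2 - 20 m\<^sup>2 g + 72 m\<^sup>3) / 16\<close>, this discriminant
  has two real zeros in \<open>g\<close>, near \<open>-9.08 m\<close> and exactly at \<open>-18 m\<close>, and it is again nonnegative for
  \<open>g \<le> -18 m\<close>: the set of all stable \<open>g\<close> is a half-line together with the component of \<open>0\<close>.\<close>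

text \<open>All square roots of complex numbers below are taken with the principal branch \<open>csqrt\<close>; every
  such root occurs with both signs, so both complex square roots are covered.\<close>

definition type_III_values :: "real \<Rightarrow> real \<Rightarrow> complex set" where
  "type_III_values m g =
     {s * \<i> * csqrt ((of_real (type_III_gamma m g)
          + t * csqrt (of_real ((type_III_gamma m g)\<^sup>2 + 2 * m * g ^ 3))) / 2) | s t.
        s \<in> {1, - 1} \<and> t \<in> {1, - 1}}
     \<union> {s * \<i> * of_real (g / 2) | s. s \<in> {1, - 1}}
     \<union> {s * \<i> * of_real (3 * m + g / 2) | s. s \<in> {1, - 1}}"

definition type_IV_values :: "real \<Rightarrow> real \<Rightarrow> complex set" where
  "type_IV_values m g =
     {s * \<i> * csqrt (of_real (m * (9 * m + 2 * g))) | s. s \<in> {1, - 1}}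
     \<union> {s * \<i> * of_real (g / 3) | s. s \<in> {1, - 1}}
     \<union> {s * \<i> * of_real (3 * m - g / 3) | s. s \<in> {1, - 1}}"

end

theory Submission
  imports Defs
begin

text \<open>Without inter-cell hopping the stability matrix is block diagonal with one \<open>6 \<times> 6\<close> block per
  cell, and for \<open>z \<noteq> 0\<close> it has the eigenvalue \<open>z\<close> iff some block of \<open>\<L>\<^sub>+ \<L>\<^sub>-\<close> has the eigenvalue
  \<open>- z\<^sup>2\<close>.  Each block splits further under the permutations of sites that preserve the breather, down
  to size at most 2.\<close>

section \<open>Block decomposition of the stability matrix over unit cells\<close>

lemma UNIV_sublattice: "(UNIV :: sublattice set) = {SubA, SubB, SubC}"
  using sublattice.exhaust by blast

lemma ex_sublattice: "(\<exists>s. P s) \<longleftrightarrow> P SubA \<or> P SubB \<or> P SubC"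
  by (metis sublattice.exhaust)

lemma all_sublattice: "(\<forall>s. P s) \<longleftrightarrow> P SubA \<and> P SubB \<and> P SubC"
  by (metis sublattice.exhaust)

lemma sum_sites:
  fixes f :: "'c::finite \<times> sublattice \<Rightarrow> 'b::comm_monoid_add"
  shows "(\<Sum>a\<in>UNIV. f a) = (\<Sum>R\<in>UNIV. f (R, SubA) + f (R, SubB) + f (R, SubC))"
proof -
  have "(\<Sum>a\<in>UNIV. f a) = (\<Sum>R\<in>UNIV. \<Sum>s\<in>UNIV. f (R, s))"
    by (simp add: sum.cartesian_product)
  then show ?thesis by (simp add: UNIV_sublattice add.assoc)
qed

text \<open>\<open>d\<close> is the diagonal of the block of a linearization belonging to one cell; the hopping
  inside a cell is \<open>m\<close> times (identity minus the all-ones matrix).\<close>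

definition cell_op :: "real \<Rightarrow> (sublattice \<Rightarrow> real) \<Rightarrow> (sublattice \<Rightarrow> complex) \<Rightarrow> sublattice \<Rightarrow> complex"
  where "cell_op m d f s =
    of_real (m + d s) * f s - of_real m * (f SubA + f SubB + f SubC)"

text \<open>Here \<open>d\<close> and \<open>e\<close> are the diagonals of the cell blocks of
  \<open>\<L>\<^sub>-\<close> and \<open>\<L>\<^sub>+\<close>, in this order, and \<open>x\<close>,
  \<open>y\<close> are the upper and lower halves of an eigenvector restricted to the cell.\<close>

definition cell_mode :: "real \<Rightarrow> (sublattice \<Rightarrow> real) \<Rightarrow> (sublattice \<Rightarrow> real) \<Rightarrow> complex \<Rightarrow> bool"
  where "cell_mode m d e z \<longleftrightarrow> (\<exists>x y. (\<exists>s. x s \<noteq> 0 \<or> y s \<noteq> 0) \<and>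
    (\<forall>s. - cell_op m e y s = z * x s) \<and> (\<forall>s. cell_op m d x s = z * y s))"

text \<open>Hopping never leaves a cell, so only the three terms with the same cell survive. The
  sign \<open>s\<close> stays free so that one computation serves both off-diagonal blocks of the
  stability matrix.\<close>

lemma linearization_hopping_sum:
  fixes f :: "'c::finite \<times> sublattice \<Rightarrow> complex"
  shows "(\<Sum>b\<in>UNIV. of_real (linearization s (hopping m) g \<omega> \<phi> $ (R, \<alpha>) $ b) * f b) =
    cell_op m (\<lambda>\<beta>. (2 + s) * g * (\<phi> $ (R, \<beta>))\<^sup>2 - \<omega>) (\<lambda>\<beta>. f (R, \<beta>)) \<alpha>"
proof -
  let ?G = "\<lambda>b. of_real (linearization s (hopping m) g \<omega> \<phi> $ (R, \<alpha>) $ b) * f b"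
  have "(\<Sum>b\<in>UNIV. ?G b) =
     (\<Sum>R'\<in>UNIV. if R = R' then ?G (R, SubA) + ?G (R, SubB) + ?G (R, SubC) else 0)"
    unfolding sum_sites by (rule sum.cong) (auto simp: linearization_def hopping_def)
  also have "\<dots> = ?G (R, SubA) + ?G (R, SubB) + ?G (R, SubC)"
    by simp
  also have "\<dots> = cell_op m (\<lambda>\<beta>. (2 + s) * g * (\<phi> $ (R, \<beta>))\<^sup>2 - \<omega>) (\<lambda>\<beta>. f (R, \<beta>)) \<alpha>"
    by (cases \<alpha>) (simp_all add: linearization_def hopping_def cell_op_def algebra_simps)
  finally show ?thesis .
qed

text \<open>An eigenvector restricts to a mode on any cell where it does not vanish; conversely, a
  mode of one cell extended by zero is an eigenvector.\<close>

lemma eigenvalue_stability_matrix_iff: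
  fixes \<phi> :: "real ^ ('c::finite \<times> sublattice)"
  shows "z \<in> eigenvalues (stability_matrix (hopping m) g \<omega> \<phi>) \<longleftrightarrow>
    (\<exists>R. cell_mode m (\<lambda>\<alpha>. g * (\<phi> $ (R, \<alpha>))\<^sup>2 - \<omega>) (\<lambda>\<alpha>. 3 * g * (\<phi> $ (R, \<alpha>))\<^sup>2 - \<omega>) z)"
    (is "?L \<longleftrightarrow> (\<exists>R. cell_mode m (?d R) (?e R) z)")
proof -
  let ?M = "map_matrix complex_of_real (stability_matrix (hopping m) g \<omega> \<phi>)"
  have inl: "(?M *v w) $ Inl (R, \<alpha>) = - cell_op m (?e R) (\<lambda>\<beta>. w $ Inr (R, \<beta>)) \<alpha>" for w R \<alpha>
    unfolding matrix_vector_mult_def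
    using linearization_hopping_sum[of 1 m g \<omega> \<phi> R \<alpha> "\<lambda>b. w $ Inr b"]
    by (simp flip: UNIV_Plus_UNIV add: sum.Plus stability_matrix_def map_matrix_def sum_negf)
  have inr: "(?M *v w) $ Inr (R, \<alpha>) = cell_op m (?d R) (\<lambda>\<beta>. w $ Inl (R, \<beta>)) \<alpha>" for w R \<alpha>
    unfolding matrix_vector_mult_def
    using linearization_hopping_sum[of "-1" m g \<omega> \<phi> R \<alpha> "\<lambda>b. w $ Inl b"]
    by (simp flip: UNIV_Plus_UNIV add: sum.Plus stability_matrix_def map_matrix_def)
  have eq: "?M *v w = z *s w \<longleftrightarrow>
    (\<forall>R \<alpha>. - cell_op m (?e R) (\<lambda>\<beta>. w $ Inr (R, \<beta>)) \<alpha> = z * w $ Inl (R, \<alpha>)) \<and>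
    (\<forall>R \<alpha>. cell_op m (?d R) (\<lambda>\<beta>. w $ Inl (R, \<beta>)) \<alpha> = z * w $ Inr (R, \<alpha>))" for w
    unfolding vec_eq_iff split_sum_all split_paired_All inl inr by simp
  have nz: "w \<noteq> 0 \<longleftrightarrow> (\<exists>R \<alpha>. w $ Inl (R, \<alpha>) \<noteq> 0 \<or> w $ Inr (R, \<alpha>) \<noteq> 0)"
    for w :: "complex ^ (('c \<times> sublattice) + ('c \<times> sublattice))"
    unfolding vec_eq_iff split_sum_all split_paired_All by auto
  show ?thesis
  proof
    assume ?L
    then obtain w where w: "w \<noteq> 0" "?M *v w = z *s w"
      unfolding eigenvalues_def by blast
    from w(1) obtain R \<alpha> where R: "w $ Inl (R, \<alpha>) \<noteq> 0 \<or> w $ Inr (R, \<alpha>) \<noteq> 0"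
      unfolding nz by blast
    have "cell_mode m (?d R) (?e R) z"
      unfolding cell_mode_def
      by (rule exI[of _ "\<lambda>\<beta>. w $ Inl (R, \<beta>)"], rule exI[of _ "\<lambda>\<beta>. w $ Inr (R, \<beta>)"])
        (use R w(2) eq in blast)
    then show "\<exists>R. cell_mode m (?d R) (?e R) z" ..
  next
    assume "\<exists>R. cell_mode m (?d R) (?e R) z"
    then obtain R x y where xy: "\<exists>s. x s \<noteq> 0 \<or> y s \<noteq> 0"
      "\<And>s. - cell_op m (?e R) y s = z * x s" "\<And>s. cell_op m (?d R) x s = z * y s"
      unfolding cell_mode_def by blast
    define w :: "complex ^ (('c \<times> sublattice) + ('c \<times> sublattice))" where
      "w = (\<chi> i. case i of Inl a \<Rightarrow> if fst a = R then x (snd a) else 0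
                       | Inr a \<Rightarrow> if fst a = R then y (snd a) else 0)"
    have "w \<noteq> 0"
      unfolding nz using xy(1) by (auto simp: w_def)
    moreover have "?M *v w = z *s w"
    proof -
      have "- cell_op m (?e R') (\<lambda>\<beta>. w $ Inr (R', \<beta>)) \<alpha> = z * w $ Inl (R', \<alpha>)
        \<and> cell_op m (?d R') (\<lambda>\<beta>. w $ Inl (R', \<beta>)) \<alpha> = z * w $ Inr (R', \<alpha>)" for R' \<alpha>
        using xy(2,3) by (cases "R' = R") (simp_all add: w_def cell_op_def)
      then show ?thesis unfolding eq by blast
    qed
    ultimately show ?L unfolding eigenvalues_def by blast
  qed
qed

section \<open>Nonzero eigenvalues of a single block\<close>

text \<open>With constant diagonal \<open>c\<close>, the operator \<open>cell_op\<close> acts as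
  \<open>c - 2 * m\<close> on the all-ones vector and as \<open>c + m\<close> on vectors of sum
  zero. The two alternatives are the products of these scalars for \<open>d\<close> and
  \<open>e\<close>. This covers empty cells and the occupied cell of Type IV.\<close>

lemma cell_mode_uniform_iff:
  assumes "z \<noteq> 0"
  shows "cell_mode m (\<lambda>_. d) (\<lambda>_. e) z \<longleftrightarrow>
    z\<^sup>2 = - of_real ((d - 2 * m) * (e - 2 * m)) \<or> z\<^sup>2 = - of_real ((d + m) * (e + m))"
proof
  assume "cell_mode m (\<lambda>_. d) (\<lambda>_. e) z"
  then obtain x y where nz: "\<exists>s. x s \<noteq> 0 \<or> y s \<noteq> 0"
    and x: "\<And>s. - cell_op m (\<lambda>_. e) y s = z * x s" and y: "\<And>s. cell_op m (\<lambda>_. d) x s = z * y s"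
    unfolding cell_mode_def by blast
  note x = x[unfolded cell_op_def] and y = y[unfolded cell_op_def]
  show "z\<^sup>2 = - of_real ((d - 2 * m) * (e - 2 * m)) \<or> z\<^sup>2 = - of_real ((d + m) * (e + m))"
  proof (rule ccontr)
    assume neg: "\<not> ?thesis"
    define X where "X = x SubA + x SubB + x SubC"
    define Y where "Y = y SubA + y SubB + y SubC"
    \<comment> \<open>Adding the three components projects onto the all-ones direction.\<close>
    have "- of_real (e - 2 * m) * Y = z * X"
      using x[of SubA] x[of SubB] x[of SubC] unfolding X_def Y_def of_real_add of_real_diff of_real_mult of_real_numeral by algebra
    moreover have "of_real (d - 2 * m) * X = z * Y"
      using y[of SubA] y[of SubB] y[of SubC] unfolding X_def Y_def of_real_add of_real_diff of_real_mult of_real_numeral by algebra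
    ultimately have "(z\<^sup>2 + of_real ((d - 2 * m) * (e - 2 * m))) * X = 0"
      unfolding of_real_add of_real_diff of_real_mult of_real_numeral by algebra
    then have X: "X = 0"
      using neg by (metis add_eq_0_iff2 mult_eq_0_iff)
    \<comment> \<open>Differences of two components see only the sum-zero part.\<close>
    have diff: "x s = x t" for s t
    proof -
      have "- of_real (e + m) * (y s - y t) = z * (x s - x t)"
        using x[of s] x[of t] unfolding of_real_add by algebra
      moreover have "of_real (d + m) * (x s - x t) = z * (y s - y t)"
        using y[of s] y[of t] unfolding of_real_add by algebra
      ultimately have "(z\<^sup>2 + of_real ((d + m) * (e + m))) * (x s - x t) = 0"
        unfolding of_real_add of_real_mult by algebra
      then show ?thesis
        using neg by (metis add_eq_0_iff2 mult_eq_0_iff eq_iff_diff_eq_0)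
    qed
    have "x s = 0" for s
      using X diff[of SubA s] diff[of SubB s] diff[of SubC s] by (simp add: X_def)
    then show False
      using nz y assms by auto
  qed
next
  have z: "of_real c / z * of_real b = - z" if "z\<^sup>2 = - of_real (c * b)" for c b :: real
    using that assms by (simp add: field_simps power2_eq_square)
  assume "z\<^sup>2 = - of_real ((d - 2 * m) * (e - 2 * m)) \<or> z\<^sup>2 = - of_real ((d + m) * (e + m))"
  then show "cell_mode m (\<lambda>_. d) (\<lambda>_. e) z"
  proof
    assume "z\<^sup>2 = - of_real ((d - 2 * m) * (e - 2 * m))"
    \<comment> \<open>The ratio of \<open>y\<close> to \<open>x\<close>, forced by the equation for
      \<open>\<L>\<^sub>-\<close>; the assumption on \<open>z\<close> then gives the equation for
      \<open>\<L>\<^sub>+\<close>.\<close>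
    define c where "c = of_real (d - 2 * m) / z"
    have "c * of_real (e - 2 * m) = - z"
      unfolding c_def by (rule z) fact
    moreover have "z * c = of_real (d - 2 * m)"
      using assms by (simp add: c_def)
    ultimately show ?thesis
      unfolding cell_mode_def cell_op_def all_sublattice
      by (intro exI[of _ "\<lambda>_. 1"] exI[of _ "\<lambda>_. c"]) (simp add: algebra_simps)
  next
    assume "z\<^sup>2 = - of_real ((d + m) * (e + m))"
    define c where "c = of_real (d + m) / z"
    have "c * of_real (e + m) = - z"
      unfolding c_def by (rule z) fact
    moreover have "z * c = of_real (d + m)"
      using assms by (simp add: c_def)
    ultimately show ?thesis
      unfolding cell_mode_def cell_op_def all_sublattice ex_sublattice
      by (intro exI[of _ "case_sublattice 1 (- 1) 0"] exI[of _ "case_sublattice c (- c) 0"])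
        (simp add: algebra_simps add_eq_0_iff)
  qed
qed

lemma singular_2x2_kernel:
  fixes a b c d :: "'a::field"
  assumes "a * d = b * c"
  shows "\<exists>x y. (x \<noteq> 0 \<or> y \<noteq> 0) \<and> a * x + b * y = 0 \<and> c * x + d * y = 0"
proof (cases "a = 0 \<and> b = 0")
  case True
  show ?thesis
  proof (cases "c = 0 \<and> d = 0")
    case True
    then show ?thesis using \<open>a = 0 \<and> b = 0\<close> by (intro exI[of _ 1]) simp
  next
    case False
    then show ?thesis using True by (intro exI[of _ d] exI[of _ "- c"]) auto
  qed
next
  case False
  then show ?thesis
    using assms by (intro exI[of _ b] exI[of _ "- a"]) (auto simp: algebra_simps)
qed

text \<open>The antisymmetric mode \<open>(1, -1, 0)\<close> is annihilated by \<open>\<L>\<^sub>-\<close> and contributes only the eigenvalue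
  0; on the symmetric modes \<open>(a, a, c)\<close> the product \<open>\<L>\<^sub>+ \<L>\<^sub>-\<close> is the matrix \<open>(p, q; r, s)\<close> of the proof,
  with eigenvalue \<open>- z\<^sup>2\<close>.\<close>

lemma cell_mode_type_III_iff:
  fixes m g :: real
  assumes z: "z \<noteq> 0"
  defines "d \<equiv> case_sublattice (- m) (- m) (- m - g / 2)"
    and "e \<equiv> case_sublattice (g - m) (g - m) (- m - g / 2)"
  shows "cell_mode m d e z \<longleftrightarrow>
    (2 * z\<^sup>2 + of_real (type_III_gamma m g))\<^sup>2 = of_real ((type_III_gamma m g)\<^sup>2 + 2 * m * g ^ 3)"
    (is "_ \<longleftrightarrow> ?Q")
proof -
  define M G :: complex where "M = of_real m" and "G = of_real g / 2"
  \<comment> \<open>On vectors (a, a, c), \<open>\<L>\<^sub>-\<close> has rows (-2M, -M) and (-2M,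
    -M-G), and \<open>\<L>\<^sub>+\<close> has rows (2G-2M, -M) and (-2M, -G-M). These are the
    entries of their product.\<close>
  define p q r s where "p = 4 * M\<^sup>2 - 4 * M * G + 2 * M\<^sup>2" and "q = (2 * M - 2 * G) * M + M * (M + G)"
    and "r = 4 * M\<^sup>2 + 2 * M * (M + G)" and "s = 2 * M\<^sup>2 + (M + G)\<^sup>2"
  have gam: "of_real (type_III_gamma m g) = 9 * M\<^sup>2 - 2 * M * G + G\<^sup>2"
    by (simp add: type_III_gamma_def M_def G_def power2_eq_square)
  have disc: "of_real ((type_III_gamma m g)\<^sup>2 + 2 * m * g ^ 3) = (9 * M\<^sup>2 - 2 * M * G + G\<^sup>2)\<^sup>2 + 16 * M * G ^ 3"
    unfolding of_real_add of_real_power gam by (simp add: M_def G_def power3_eq_cube)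
  \<comment> \<open>Completing the square in the characteristic equation: the trace
    \<open>p + s\<close> is gamma, and the determinant \<open>p * s - q * r\<close> is -4MG^3, so
    the discriminant is gamma^2 + 16MG^3.\<close>
  have Q: "?Q \<longleftrightarrow> (p + z\<^sup>2) * (s + z\<^sup>2) = q * r"
  proof -
    have "(2 * z\<^sup>2 + of_real (type_III_gamma m g))\<^sup>2 - of_real ((type_III_gamma m g)\<^sup>2 + 2 * m * g ^ 3)
      = 4 * ((p + z\<^sup>2) * (s + z\<^sup>2) - q * r)"
      unfolding gam disc p_def q_def r_def s_def by algebra
    then show ?thesis
      by (metis eq_iff_diff_eq_0 mult_eq_0_iff zero_neq_numeral)
  qed
  show ?thesis
  proof
    assume "cell_mode m d e z"
    then obtain x y where nz: "\<exists>s. x s \<noteq> 0 \<or> y s \<noteq> 0"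
      and x: "\<And>s. - cell_op m e y s = z * x s" and y: "\<And>s. cell_op m d x s = z * y s"
      unfolding cell_mode_def by blast
    have y1: "- M * (x SubA + x SubB + x SubC) = z * y SubA"
      and y2: "- M * (x SubA + x SubB + x SubC) = z * y SubB"
      and y3: "- G * x SubC - M * (x SubA + x SubB + x SubC) = z * y SubC"
      using y[of SubA] y[of SubB] y[of SubC] by (simp_all add: cell_op_def d_def M_def G_def)
    have x1: "- (2 * G * y SubA) + M * (y SubA + y SubB + y SubC) = z * x SubA"
      and x2: "- (2 * G * y SubB) + M * (y SubA + y SubB + y SubC) = z * x SubB"
      and x3: "G * y SubC + M * (y SubA + y SubB + y SubC) = z * x SubC"
      using x[of SubA] x[of SubB] x[of SubC] by (simp_all add: cell_op_def e_def M_def G_def add.commute)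
    \<comment> \<open>The rows of \<open>\<L>\<^sub>-\<close> for \<open>SubA\<close> and
      \<open>SubB\<close> coincide because the entry -m of \<open>d\<close> cancels the diagonal m;
      with \<open>z\<close> nonzero the mode must be symmetric.\<close>
    have yAB: "y SubB = y SubA" using y1 y2 z by simp
    then have xAB: "x SubB = x SubA" using x1 x2 z by simp
    have 1: "(p + z\<^sup>2) * x SubA + q * x SubC = 0"
      using y1 y3 x1 unfolding p_def q_def yAB xAB by algebra
    have 2: "r * x SubA + (s + z\<^sup>2) * x SubC = 0"
      using y1 y3 x3 unfolding r_def s_def yAB xAB by algebra
    have "x SubA \<noteq> 0 \<or> x SubC \<noteq> 0"
    proof (rule ccontr)
      assume "\<not> ?thesis"
      then have "x s = 0" for s by (cases s) (auto simp: xAB)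
      then show False using nz y z by (auto simp: cell_op_def)
    qed
    moreover have "((p + z\<^sup>2) * (s + z\<^sup>2) - q * r) * x SubA = 0"
      "((p + z\<^sup>2) * (s + z\<^sup>2) - q * r) * x SubC = 0"
      using 1 2 by algebra+
    ultimately show ?Q unfolding Q by auto
  next
    assume ?Q
    then have "(p + z\<^sup>2) * (s + z\<^sup>2) = q * r" using Q by blast
    from singular_2x2_kernel[OF this] obtain a c where ac: "a \<noteq> 0 \<or> c \<noteq> 0"
      "(p + z\<^sup>2) * a + q * c = 0" "r * a + (s + z\<^sup>2) * c = 0" by blast
    \<comment> \<open>The lower half of the eigenvector is \<open>\<L>\<^sub>-\<close> applied to
      (a, a, c), divided by \<open>z\<close>.\<close>
    define b where "b = - M * (2 * a + c) / z"
    define f where "f = (- G * c - M * (2 * a + c)) / z"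
    have b: "z * b = - M * (2 * a + c)" and f: "z * f = - G * c - M * (2 * a + c)"
      using z by (simp_all add: b_def f_def)
    \<comment> \<open>The extra factor \<open>z\<close> leaves only \<open>z * b\<close> and
      \<open>z * f\<close>, which are polynomial in a and c; it is cancelled afterwards.\<close>
    have "z * (- (2 * G * b) + M * (2 * b + f)) = z * (z * a)"
      using ac(2) b f unfolding p_def q_def by algebra
    then have xa: "- (2 * G * b) + M * (2 * b + f) = z * a" using z by simp
    have "z * (G * f + M * (2 * b + f)) = z * (z * c)"
      using ac(3) b f unfolding r_def s_def by algebra
    then have xc: "G * f + M * (2 * b + f) = z * c" using z by simp
    show "cell_mode m d e z"
      unfolding cell_mode_def ex_sublattice all_sublattice
      using ac(1) b f xa xc
      by (intro exI[of _ "case_sublattice a a c"] exI[of _ "case_sublattice b b f"])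
        (auto simp: cell_op_def d_def e_def M_def G_def algebra_simps)
  qed
qed

section \<open>Explicit square roots versus equations for the square of \<open>z\<close>\<close>

lemma power2_eq_iff_csqrt: "z\<^sup>2 = w \<longleftrightarrow> (\<exists>s\<in>{1, - 1}. z = s * csqrt w)"
  using power2_eq_iff[of z "csqrt w"] by simp

lemma power2_eq_minus_iff_csqrt: "z\<^sup>2 = - w \<longleftrightarrow> (\<exists>s\<in>{1, - 1}. z = s * \<i> * csqrt w)"
  using power2_eq_iff[of z "\<i> * csqrt w"] by (simp add: power_mult_distrib)

lemma power2_eq_minus_of_real_square_iff:
  "z\<^sup>2 = - of_real (a * a) \<longleftrightarrow> (\<exists>s\<in>{1, - 1}. z = s * \<i> * of_real a)"
proof -
  have "(\<i> * of_real a)\<^sup>2 = - of_real (a * a)"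
    by (simp add: power_mult_distrib flip: power2_eq_square)
  then show ?thesis
    using power2_eq_iff[of z "\<i> * of_real a"] by simp
qed

text \<open>Removes all square roots, giving the form produced by the mode lemmas and needed to test
  whether \<open>z\<close> is imaginary.\<close>

lemma type_III_values_iff:
  "z \<in> type_III_values m g \<longleftrightarrow>
    (2 * z\<^sup>2 + of_real (type_III_gamma m g))\<^sup>2 = of_real ((type_III_gamma m g)\<^sup>2 + 2 * m * g ^ 3)
    \<or> z\<^sup>2 = - of_real (g / 2 * (g / 2)) \<or> z\<^sup>2 = - of_real ((3 * m + g / 2) * (3 * m + g / 2))"
proof -
  let ?\<gamma> = "of_real (type_III_gamma m g) :: complex"
  let ?D = "of_real ((type_III_gamma m g)\<^sup>2 + 2 * m * g ^ 3) :: complex"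
  \<comment> \<open>The sign is flipped before the inner root is taken so that each \<open>t\<close>
    matches the one in \<open>type_III_values\<close>.\<close>
  have "(2 * z\<^sup>2 + ?\<gamma>)\<^sup>2 = ?D \<longleftrightarrow> (- (2 * z\<^sup>2 + ?\<gamma>))\<^sup>2 = ?D"
    by (simp only: power2_minus)
  also have "\<dots> \<longleftrightarrow> (\<exists>t\<in>{1, - 1}. - (2 * z\<^sup>2 + ?\<gamma>) = t * csqrt ?D)"
    by (rule power2_eq_iff_csqrt)
  also have "\<dots> \<longleftrightarrow> (\<exists>t\<in>{1, - 1}. z\<^sup>2 = - ((?\<gamma> + t * csqrt ?D) / 2))"
    by (intro bex_cong refl) (auto simp: field_simps)
  finally have "(2 * z\<^sup>2 + ?\<gamma>)\<^sup>2 = ?D \<longleftrightarrow>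
      (\<exists>t\<in>{1, - 1}. \<exists>s\<in>{1, - 1}. z = s * \<i> * csqrt ((?\<gamma> + t * csqrt ?D) / 2))"
    unfolding power2_eq_minus_iff_csqrt .
  then show ?thesis
    unfolding power2_eq_minus_of_real_square_iff type_III_values_def by blast
qed

lemma type_IV_values_iff:
  "z \<in> type_IV_values m g \<longleftrightarrow> z\<^sup>2 = - of_real (m * (9 * m + 2 * g))
    \<or> z\<^sup>2 = - of_real (g / 3 * (g / 3)) \<or> z\<^sup>2 = - of_real ((3 * m - g / 3) * (3 * m - g / 3))"
  \<comment> \<open>The second rule is instantiated because in general form it would also match the
    two perfect squares.\<close>
  unfolding power2_eq_minus_of_real_square_iff
    power2_eq_minus_iff_csqrt[of z "of_real (m * (9 * m + 2 * g))"] type_IV_values_def by blast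

section \<open>Spectra of the Type III and Type IV breathers\<close>

text \<open>All empty cells have the same block, with both diagonals equal to minus the frequency.
  At least two cells are required so that an empty one exists and its modes do occur.\<close>

lemma eigenvalue_single_cell_iff:
  fixes R\<^sub>0 :: "'c::finite"
  assumes "CARD('c) \<ge> 2"
  shows "z \<in> eigenvalues (stability_matrix (hopping m) g \<omega> (single_cell R\<^sub>0 v)) \<longleftrightarrow>
    cell_mode m (\<lambda>\<alpha>. g * (v $ \<alpha>)\<^sup>2 - \<omega>) (\<lambda>\<alpha>. 3 * g * (v $ \<alpha>)\<^sup>2 - \<omega>) z
    \<or> cell_mode m (\<lambda>_. - \<omega>) (\<lambda>_. - \<omega>) z"
proof -
  have "\<exists>R. R \<noteq> R\<^sub>0"
  proof (rule ccontr)
    assume "\<nexists>R. R \<noteq> R\<^sub>0"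
    then have "(UNIV :: 'c set) = {R\<^sub>0}" by auto
    then have "CARD('c) = card {R\<^sub>0}" by (rule arg_cong)
    then show False using assms by simp
  qed
  then obtain R\<^sub>1 where R1: "R\<^sub>1 \<noteq> R\<^sub>0" ..
  let ?P = "\<lambda>R. cell_mode m (\<lambda>\<alpha>. g * (single_cell R\<^sub>0 v $ (R, \<alpha>))\<^sup>2 - \<omega>)
    (\<lambda>\<alpha>. 3 * g * (single_cell R\<^sub>0 v $ (R, \<alpha>))\<^sup>2 - \<omega>) z"
  have 0: "?P R\<^sub>0 \<longleftrightarrow> cell_mode m (\<lambda>\<alpha>. g * (v $ \<alpha>)\<^sup>2 - \<omega>) (\<lambda>\<alpha>. 3 * g * (v $ \<alpha>)\<^sup>2 - \<omega>) z"
    by (simp add: single_cell_def)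
  have 1: "?P R \<longleftrightarrow> cell_mode m (\<lambda>_. - \<omega>) (\<lambda>_. - \<omega>) z" if "R \<noteq> R\<^sub>0" for R
    using that by (simp add: single_cell_def)
  show ?thesis
    unfolding eigenvalue_stability_matrix_iff using 0 1 R1 by metis
qed

lemma eigenvalue_type_III_iff:
  fixes R\<^sub>0 :: "'c::finite"
  assumes "CARD('c) \<ge> 2" and z: "z \<noteq> 0"
  shows "z \<in> eigenvalues (stability_matrix (hopping m) g (m + g / 2) (single_cell R\<^sub>0 type_III)) \<longleftrightarrow>
    z \<in> type_III_values m g"
proof -
  have d: "(\<lambda>\<alpha>. g * (type_III $ \<alpha>)\<^sup>2 - (m + g / 2)) = case_sublattice (- m) (- m) (- m - g / 2)"
    and e: "(\<lambda>\<alpha>. 3 * g * (type_III $ \<alpha>)\<^sup>2 - (m + g / 2)) = case_sublattice (g - m) (g - m) (- m - g / 2)"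
    by (auto simp: fun_eq_iff type_III_def power_divide split: sublattice.split)
  have vac: "cell_mode m (\<lambda>_. - (m + g / 2)) (\<lambda>_. - (m + g / 2)) z \<longleftrightarrow>
    z\<^sup>2 = - of_real (g / 2 * (g / 2)) \<or> z\<^sup>2 = - of_real ((3 * m + g / 2) * (3 * m + g / 2))"
    unfolding cell_mode_uniform_iff[OF z] by (auto simp: algebra_simps)
  show ?thesis
    unfolding eigenvalue_single_cell_iff[OF assms(1)] d e cell_mode_type_III_iff[OF z] vac
      type_III_values_iff ..
qed

lemma eigenvalue_type_IV_iff:
  fixes R\<^sub>0 :: "'c::finite"
  assumes "CARD('c) \<ge> 2" and z: "z \<noteq> 0"
  shows "z \<in> eigenvalues (stability_matrix (hopping m) g (- 2 * m + g / 3) (single_cell R\<^sub>0 type_IV)) \<longleftrightarrow>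
    z \<in> type_IV_values m g"
proof -
  have d: "(\<lambda>\<alpha>. g * (type_IV $ \<alpha>)\<^sup>2 - (- 2 * m + g / 3)) = (\<lambda>_. 2 * m)"
    and e: "(\<lambda>\<alpha>. 3 * g * (type_IV $ \<alpha>)\<^sup>2 - (- 2 * m + g / 3)) = (\<lambda>_. 2 * m + 2 * g / 3)"
    by (auto simp: fun_eq_iff type_IV_def power_divide)
  \<comment> \<open>The all-ones alternative is the phase mode: the breather lies in the kernel of
    \<open>\<L>\<^sub>-\<close>, which gives only \<open>z = 0\<close>.\<close>
  have core: "cell_mode m (\<lambda>_. 2 * m) (\<lambda>_. 2 * m + 2 * g / 3) z \<longleftrightarrow> z\<^sup>2 = - of_real (m * (9 * m + 2 * g))"
  proof -
    have "(2 * m + m) * (2 * m + 2 * g / 3 + m) = m * (9 * m + 2 * g)"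
      "(2 * m - 2 * m) * (2 * m + 2 * g / 3 - 2 * m) = 0" by (simp_all add: algebra_simps)
    then show ?thesis using z unfolding cell_mode_uniform_iff[OF z] by (simp only:) simp
  qed
  have vac: "cell_mode m (\<lambda>_. - (- 2 * m + g / 3)) (\<lambda>_. - (- 2 * m + g / 3)) z \<longleftrightarrow>
    z\<^sup>2 = - of_real (g / 3 * (g / 3)) \<or> z\<^sup>2 = - of_real ((3 * m - g / 3) * (3 * m - g / 3))"
    unfolding cell_mode_uniform_iff[OF z] by (auto simp: algebra_simps)
  show ?thesis
    unfolding eigenvalue_single_cell_iff[OF assms(1)] d e core vac type_IV_values_iff ..
qed

section \<open>Linear stability and the Type III region\<close>

lemma Re_eq_0_if_square_nonpos:
  assumes "z\<^sup>2 = of_real c" and "c \<le> 0"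
  shows "Re z = 0"
proof -
  have "(Re z)\<^sup>2 - (Im z)\<^sup>2 = c" "Re z * Im z = 0"
    using assms(1) by (auto simp: complex_eq_iff power2_eq_square)
  then have "(Re z)\<^sup>2 \<le> 0" using assms(2) by (auto simp: power2_eq_square)
  then show ?thesis by simp
qed

lemma linearly_stable_iff_nonzero:
  "linearly_stable h g \<omega> \<phi> \<longleftrightarrow>
    (\<forall>z. z \<noteq> 0 \<longrightarrow> z \<in> eigenvalues (stability_matrix h g \<omega> \<phi>) \<longrightarrow> Re z = 0)"
  unfolding linearly_stable_def by (metis zero_complex.sel(1))

lemma is_breather_type_III:
  "is_breather (hopping m) g (m + g / 2) (single_cell (R\<^sub>0 :: 'c::finite) type_III)"
proof -
  let ?\<phi> = "single_cell R\<^sub>0 type_III"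
  have "(\<Sum>a\<in>UNIV. (?\<phi> $ a)\<^sup>2) = (\<Sum>R\<in>UNIV. if R = R\<^sub>0 then 1 else 0)"
    unfolding sum_sites by (rule sum.cong) (auto simp: single_cell_def type_III_def power_divide)
  moreover have "(\<Sum>b\<in>UNIV. hopping m $ (R, \<alpha>) $ b * ?\<phi> $ b) + g * (?\<phi> $ (R, \<alpha>)) ^ 3
      = (m + g / 2) * ?\<phi> $ (R, \<alpha>)" for R \<alpha>
  proof -
    let ?G = "\<lambda>b. hopping m $ (R, \<alpha>) $ b * ?\<phi> $ b"
    have "(\<Sum>b\<in>UNIV. ?G b) =
       (\<Sum>R'\<in>UNIV. if R = R' then ?G (R, SubA) + ?G (R, SubB) + ?G (R, SubC) else 0)"
      unfolding sum_sites by (rule sum.cong) (auto simp: hopping_def)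
    then have "(\<Sum>b\<in>UNIV. ?G b) = ?G (R, SubA) + ?G (R, SubB) + ?G (R, SubC)" by simp
    then show ?thesis
      by (cases \<alpha>) (auto simp: hopping_def single_cell_def type_III_def power3_eq_cube field_simps)
  qed
  ultimately show ?thesis unfolding is_breather_def by auto
qed

text \<open>Stability asks both values (-gamma +- sqrt D)/2 of z^2 to be real and nonpositive, where
  D is the discriminant. Negative D makes them non-real, and positive \<open>g\<close> gives D >
  gamma^2 and hence a positive value. For \<open>g\<close> at most 0, gamma is nonnegative and D is
  at most gamma^2.\<close>

lemma type_III_stability_region_eq:
  fixes R\<^sub>0 :: "'c::finite"
  assumes m: "m > 0" and card: "CARD('c) \<ge> 2"
  shows "type_III_stability_region m R\<^sub>0 = {g. g \<le> 0 \<and> (type_III_gamma m g)\<^sup>2 + 2 * m * g ^ 3 \<ge> 0}"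
proof -
  have "linearly_stable (hopping m) g (m + g / 2) (single_cell R\<^sub>0 type_III) \<longleftrightarrow>
    g \<le> 0 \<and> (type_III_gamma m g)\<^sup>2 + 2 * m * g ^ 3 \<ge> 0" (is "?S \<longleftrightarrow> _") for g
  proof -
    define \<gamma> where "\<gamma> = type_III_gamma m g"
    define D where "D = \<gamma>\<^sup>2 + 2 * m * g ^ 3"
    \<comment> \<open>Empty cells contribute only imaginary eigenvalues, so the quartic of the
      occupied cell decides.\<close>
    have S: "?S \<longleftrightarrow> (\<forall>z. z \<noteq> 0 \<longrightarrow> (2 * z\<^sup>2 + of_real \<gamma>)\<^sup>2 = of_real D \<longrightarrow> Re z = 0)"
    proof -
      have "Re z = 0" if "z\<^sup>2 = - of_real (a * a)" for z and a :: real
        using that Re_eq_0_if_square_nonpos[of z "- (a * a)"] by simp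
      then show ?thesis
        unfolding linearly_stable_iff_nonzero D_def \<gamma>_def
        using eigenvalue_type_III_iff[OF card] type_III_values_iff by blast
    qed
    show ?thesis unfolding \<gamma>_def[symmetric] D_def[symmetric]
    proof
      assume ?S
      then have stab: "\<And>z. z \<noteq> 0 \<Longrightarrow> (2 * z\<^sup>2 + of_real \<gamma>)\<^sup>2 = of_real D \<Longrightarrow> Re z = 0"
        unfolding S by blast
      have "g \<le> 0"
      proof (rule ccontr)
        assume "\<not> g \<le> 0"
        then have "D > \<gamma>\<^sup>2" using m by (simp add: D_def)
        then have lt: "sqrt D > \<gamma>" and D: "D \<ge> 0"
          using real_less_rsqrt by (blast, smt (verit) zero_le_power2)
        \<comment> \<open>A positive real solution of the quartic, hence an unstable
          eigenvalue.\<close>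
        define x where "x = sqrt ((sqrt D - \<gamma>) / 2)"
        have "x > 0" and x2: "x\<^sup>2 = (sqrt D - \<gamma>) / 2" using lt by (simp_all add: x_def)
        have "(2 * x\<^sup>2 + \<gamma>)\<^sup>2 = D" unfolding x2 using D by (simp add: field_simps)
        then have "of_real ((2 * x\<^sup>2 + \<gamma>)\<^sup>2) = (of_real D :: complex)"
          by (rule arg_cong)
        then have "(2 * (of_real x)\<^sup>2 + of_real \<gamma>)\<^sup>2 = (of_real D :: complex)"
          by simp
        from stab[OF _ this] \<open>x > 0\<close> show False by simp
      qed
      moreover have "D \<ge> 0"
      proof (rule ccontr)
        assume D: "\<not> D \<ge> 0"
        \<comment> \<open>Any solution will do: on the imaginary axis its square is real, which
          would make the negative number \<open>D\<close> the square of a real.\<close>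
        define z where "z = csqrt ((csqrt (of_real D) - of_real \<gamma>) / 2)"
        have z: "(2 * z\<^sup>2 + of_real \<gamma>)\<^sup>2 = of_real D" by (simp add: z_def field_simps)
        have "z \<noteq> 0"
        proof
          assume "z = 0"
          then have "of_real (\<gamma>\<^sup>2) = (of_real D :: complex)" using z by simp
          then have "\<gamma>\<^sup>2 = D" using of_real_eq_iff by blast
          then show False using D by (metis zero_le_power2)
        qed
        then have "Re z = 0" using stab z by blast
        then have "z\<^sup>2 = of_real (- (Im z)\<^sup>2)"
          by (simp add: complex_eq_iff power2_eq_square)
        with z have "of_real ((2 * (- (Im z)\<^sup>2) + \<gamma>)\<^sup>2) = (of_real D :: complex)" by simp
        then have "(2 * (- (Im z)\<^sup>2) + \<gamma>)\<^sup>2 = D" using of_real_eq_iff by blast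
        then show False using D by (metis zero_le_power2)
      qed
      ultimately show "g \<le> 0 \<and> 0 \<le> D" ..
    next
      assume g: "g \<le> 0 \<and> 0 \<le> D"
      have "m * g \<le> 0" using m g by (simp add: mult_nonneg_nonpos)
      moreover have "m\<^sup>2 \<ge> 0" "g\<^sup>2 \<ge> 0" by simp_all
      ultimately have \<gamma>: "\<gamma> \<ge> 0"
        unfolding \<gamma>_def type_III_gamma_def by linarith
      have "g ^ 3 \<le> 0" using g by (simp add: power3_eq_cube mult_nonneg_nonpos mult_nonpos_nonpos)
      then have "D \<le> \<gamma>\<^sup>2" using m by (simp add: D_def mult_nonneg_nonpos)
      then have le: "sqrt D \<le> \<gamma>" using \<gamma> by (simp add: real_le_lsqrt)
      show ?S unfolding S
      proof (intro allI impI)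
        fix z :: complex
        assume "(2 * z\<^sup>2 + of_real \<gamma>)\<^sup>2 = of_real D"
        also have "of_real D = (of_real (sqrt D))\<^sup>2" using g by (simp flip: of_real_power)
        finally have "2 * z\<^sup>2 + of_real \<gamma> = of_real (sqrt D) \<or> 2 * z\<^sup>2 + of_real \<gamma> = - of_real (sqrt D)"
          by (simp add: power2_eq_iff)
        then have "z\<^sup>2 = of_real ((sqrt D - \<gamma>) / 2) \<or> z\<^sup>2 = of_real ((- sqrt D - \<gamma>) / 2)"
          by (auto simp: field_simps)
        moreover have "0 \<le> sqrt D" using g by simp
        ultimately show "Re z = 0"
          using Re_eq_0_if_square_nonpos le \<gamma> by (smt (verit) divide_nonpos_pos)
      qed
    qed
  qed
  then show ?thesis
    unfolding type_III_stability_region_def using is_breather_type_III by blast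
qed

text \<open>The cubic is the cofactor of \<open>(g + 18 m) / 16\<close> in the discriminant \<open>\<gamma>\<^sup>2 + 2 m g\<^sup>3\<close>.\<close>

lemma type_III_cubic_root:
  fixes m :: real
  assumes m: "m > 0"
  defines "q \<equiv> \<lambda>g. g ^ 3 + 6 * m * g\<^sup>2 - 20 * m\<^sup>2 * g + 72 * m ^ 3"
  obtains r where "- 9.08 * m < r" "r < - 9.06 * m" "q r = 0"
    "\<And>g. 0 \<le> q g \<longleftrightarrow> r \<le> g"
proof -
  \<comment> \<open>The bracket is -9.07m -+ 0.01m, matching the tolerance in the theorem.\<close>
  have l: "q (- 9.08 * m) < 0" and u: "q (- 9.06 * m) > 0"
    using m by (simp_all add: q_def power2_eq_square power3_eq_cube)
  have "continuous_on {- 9.08 * m .. - 9.06 * m} q"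
    unfolding q_def by (intro continuous_intros)
  then obtain r where r: "- 9.08 * m \<le> r" "r \<le> - 9.06 * m" "q r = 0"
    using IVT'[of q "- 9.08 * m" 0 "- 9.06 * m"] l u m by auto
  have r': "- 9.08 * m < r" "r < - 9.06 * m"
    using r l u by (metis less_eq_real_def less_irrefl)+
  have "0 \<le> q g \<longleftrightarrow> r \<le> g" for g
  proof -
    \<comment> \<open>The quotient of \<open>q g - q r\<close> by \<open>g - r\<close>; its
      positivity makes \<open>r\<close> the only real root.\<close>
    define B where "B = g\<^sup>2 + g * r + r\<^sup>2 + 6 * m * (g + r) - 20 * m\<^sup>2"
    have "q g = q g - q r" using r by simp
    also have "\<dots> = (g - r) * B"
      unfolding q_def B_def by algebra
    finally have qg: "q g = (g - r) * B" .
    have "(- (r + 3 * m))\<^sup>2 > 36 * m\<^sup>2"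
      using r' m power_strict_mono[of "6 * m" "- (r + 3 * m)" 2] by (simp add: power_mult_distrib)
    moreover have "(- (r + 6 * m))\<^sup>2 < 16 * m\<^sup>2"
      using r' m power_strict_mono[of "- (r + 6 * m)" "4 * m" 2] by (simp add: power_mult_distrib)
    moreover have "m\<^sup>2 > 0" using m by simp
    \<comment> \<open>Completing the square in \<open>g\<close>. With the two bounds above, 4B
      exceeds (144 - 116 - 16) m^2 = 12 m^2.\<close>
    moreover have "4 * B = (2 * g + (r + 6 * m))\<^sup>2 + 4 * (- (r + 3 * m))\<^sup>2 - 116 * m\<^sup>2 - (- (r + 6 * m))\<^sup>2"
      unfolding B_def by algebra
    moreover have "(2 * g + (r + 6 * m))\<^sup>2 \<ge> 0" by simp
    ultimately have "B > 0" by linarith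
    then show ?thesis unfolding qg by (simp add: zero_le_mult_iff)
  qed
  with r r' that show thesis by blast
qed

theorem mainTheorem5:
  fixes m g \<omega> :: real
    and R\<^sub>0 :: "'c::finite"
    and v :: "real ^ sublattice"
    and \<phi> :: "real ^ ('c \<times> sublattice)"
  assumes "m > 0" and "g \<noteq> 0" and "CARD('c) \<ge> 2"
    and "is_breather (hopping m) g \<omega> \<phi>"
    and "\<phi> = single_cell R\<^sub>0 v"
  shows "(v = type_III \<and> \<omega> = m + g / 2 \<longrightarrow>
            nonzero_stability_spectrum (hopping m) g \<omega> \<phi> = type_III_values m g - {0})
       \<and> (\<exists>g\<^sub>l. \<bar>g\<^sub>l - (- 9.07 * m)\<bar> < 0.01 * m
              \<and> (type_III_gamma m g\<^sub>l)\<^sup>2 + 2 * m * g\<^sub>l ^ 3 = 0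
              \<and> connected_component_set (type_III_stability_region m R\<^sub>0) 0 = {g\<^sub>l..0}
              \<and> type_III_stability_region m R\<^sub>0 = {.. - 18 * m} \<union> {g\<^sub>l..0})
       \<and> (v = type_IV \<and> \<omega> = - 2 * m + g / 3 \<longrightarrow>
            nonzero_stability_spectrum (hopping m) g \<omega> \<phi> = type_IV_values m g - {0}
            \<and> (g \<ge> - (9 * m / 2) \<longrightarrow> linearly_stable (hopping m) g \<omega> \<phi>))"
proof (intro conjI impI)
  assume "v = type_III \<and> \<omega> = m + g / 2"
  then show "nonzero_stability_spectrum (hopping m) g \<omega> \<phi> = type_III_values m g - {0}"
    using eigenvalue_type_III_iff[OF assms(3)] assms(5)
    unfolding nonzero_stability_spectrum_def by blast
next
  obtain r where r: "- 9.08 * m < r" "r < - 9.06 * m"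
    and r0: "r ^ 3 + 6 * m * r\<^sup>2 - 20 * m\<^sup>2 * r + 72 * m ^ 3 = 0"
    and q: "\<And>g. 0 \<le> g ^ 3 + 6 * m * g\<^sup>2 - 20 * m\<^sup>2 * g + 72 * m ^ 3 \<longleftrightarrow> r \<le> g"
    using type_III_cubic_root[OF assms(1)] by blast
  have disc: "(type_III_gamma m x)\<^sup>2 + 2 * m * x ^ 3 =
      (x + 18 * m) * (x ^ 3 + 6 * m * x\<^sup>2 - 20 * m\<^sup>2 * x + 72 * m ^ 3) / 16" for x
    by (simp add: type_III_gamma_def power2_eq_square power3_eq_cube field_simps)
  let ?S = "type_III_stability_region m R\<^sub>0"
  have region: "?S = {.. - 18 * m} \<union> {r..0}"
  proof -
    have "x \<le> 0 \<and> (type_III_gamma m x)\<^sup>2 + 2 * m * x ^ 3 \<ge> 0 \<longleftrightarrow> x \<le> - 18 * m \<or> r \<le> x \<and> x \<le> 0" for x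
    proof -
      let ?q = "x ^ 3 + 6 * m * x\<^sup>2 - 20 * m\<^sup>2 * x + 72 * m ^ 3"
      have "(type_III_gamma m x)\<^sup>2 + 2 * m * x ^ 3 \<ge> 0 \<longleftrightarrow>
          x + 18 * m \<ge> 0 \<and> ?q \<ge> 0 \<or> x + 18 * m \<le> 0 \<and> ?q \<le> 0"
        unfolding disc by (simp only: zero_le_divide_iff zero_le_mult_iff) simp
      note D = this
      have r18: "- 18 * m < r" "r < 0" using r assms(1) by simp_all
      show ?thesis
      \<comment> \<open>Since -18m < r, both factors are nonnegative from \<open>r\<close> on; to
        the left of \<open>r\<close> the cubic is negative and the linear factor must be at most
        0.\<close>
      proof (cases "r \<le> x")
        case True
        then have "?q \<ge> 0" "x + 18 * m > 0" using q[of x] r18 by simp_all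
        then show ?thesis using True unfolding D by auto
      next
        case False
        then have "?q < 0" "x < 0" using q[of x] r18 by (simp_all add: not_le[symmetric])
        then show ?thesis using False unfolding D by auto
      qed
    qed
    then show ?thesis
      unfolding type_III_stability_region_eq[OF assms(1,3)]
      by (intro set_eqI) (simp only: mem_Collect_eq Un_iff atMost_iff atLeastAtMost_iff)
  qed
  have "\<bar>r - (- 9.07 * m)\<bar> < 0.01 * m"
    unfolding abs_less_iff using r by (simp add: field_simps)
  moreover have "(type_III_gamma m r)\<^sup>2 + 2 * m * r ^ 3 = 0"
    unfolding disc r0 by simp
  moreover have "connected_component_set ?S 0 = {r..0}"
  proof
    have 0: "0 \<in> ?S" unfolding region using r assms(1) by simp
    \<comment> \<open>The point -10m lies strictly between -18m and \<open>r\<close>, so it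
      separates the half-line from the component of 0.\<close>
    have gap: "- 10 * m \<notin> ?S" unfolding region using r assms(1) by simp
    show "connected_component_set ?S 0 \<subseteq> {r..0}"
    proof
      fix y assume y: "y \<in> connected_component_set ?S 0"
      have yS: "y \<in> ?S" using y connected_component_subset by blast
      show "y \<in> {r..0}"
      proof (rule ccontr)
        assume "y \<notin> {r..0}"
        then have "y \<le> - 10 * m" using yS assms(1) unfolding region by auto
        \<comment> \<open>A connected subset of the line is an interval, so a component reaching the
          half-line would contain the gap point.\<close>
        moreover have "is_interval (connected_component_set ?S 0)"
          by (simp add: is_interval_connected_1)
        moreover have "0 \<in> connected_component_set ?S 0"
          using 0 by (simp add: connected_component_refl)
        moreover have "- 10 * m \<le> 0" using assms(1) by simp
        ultimately have "- 10 * m \<in> connected_component_set ?S 0"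
          using y unfolding is_interval_1 by blast
        then show False using gap connected_component_subset by blast
      qed
    qed
    show "{r..0} \<subseteq> connected_component_set ?S 0"
      using r assms(1) by (intro connected_component_maximal) (auto simp: region)
  qed
  ultimately show "\<exists>g\<^sub>l. \<bar>g\<^sub>l - (- 9.07 * m)\<bar> < 0.01 * m
              \<and> (type_III_gamma m g\<^sub>l)\<^sup>2 + 2 * m * g\<^sub>l ^ 3 = 0
              \<and> connected_component_set (type_III_stability_region m R\<^sub>0) 0 = {g\<^sub>l..0}
              \<and> type_III_stability_region m R\<^sub>0 = {.. - 18 * m} \<union> {g\<^sub>l..0}"
    using region by blast
next
  assume IV: "v = type_IV \<and> \<omega> = - 2 * m + g / 3"
  then show "nonzero_stability_spectrum (hopping m) g \<omega> \<phi> = type_IV_values m g - {0}"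
    using eigenvalue_type_IV_iff[OF assms(3)] assms(5)
    unfolding nonzero_stability_spectrum_def by blast
  assume "g \<ge> - (9 * m / 2)"
  then have "m * (9 * m + 2 * g) \<ge> 0" using assms(1) by simp
  moreover have "Re z = 0" if "z\<^sup>2 = - of_real c" "c \<ge> 0" for z c
    using Re_eq_0_if_square_nonpos[of z "- c"] that by simp
  \<comment> \<open>All three squares in \<open>type_IV_values_iff\<close> are nonpositive: the
    first by the bound on \<open>g\<close>, the others as negated perfect squares.\<close>
  ultimately have "Re z = 0" if "z \<in> type_IV_values m g" for z
    using that zero_le_square unfolding type_IV_values_iff by blast
  then show "linearly_stable (hopping m) g \<omega> \<phi>"
    unfolding linearly_stable_iff_nonzero
    using eigenvalue_type_IV_iff[OF assms(3)] assms(5) IV by blast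
qed

end
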